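(* Consider the equation in $Y$ $$e+h\,d\,Y+c\,Y^2+h\,b\,Y^3+a\,Y^4+h\,Y^5=0,\qquad(\ast)$$ where $$e=\sqrt{1-x^2}\,(1-4x^2+6x^4-4x^6+x^8),\quad d=1-6x^4+8x^6-3x^8,\quad c=\sqrt{1-x^2}\,(-2+8x^2-6x^4),$$ $$b=-2+6x^4-4x^6,\quad a=(1-4x^2)\sqrt{1-x^2}.$$ If $h=\operatorname{sn}(3u)$ and $x=\operatorname{dn}(u)$ (Jacobi elliptic functions of modulus $k=k_r$) are the parameters related with the coefficients of $(\ast)$ in this way, then a root of $(\ast)$ is $Y=k=k_r$. Hence $(\ast)$ is equivalent to $$\frac{\operatorname{sn}^{(-1)}(h,m_0)}{\operatorname{dn}^{(-1)}(x,m_0)}=3\quad\text{and}\quad Y=\sqrt{m_0}.$$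
   Context: $\operatorname{sn}(u)=\operatorname{sn}(u,m)$, $\operatorname{cn}(u)=\operatorname{cn}(u,m)$, $\operatorname{dn}(u)=\operatorname{dn}(u,m)$ are the Jacobi elliptic functions with parameter $m=k^2$: with $u=\int_0^{\operatorname{am}(u)}\frac{d\theta}{\sqrt{1-k^2\sin^2\theta}}$ one has $\operatorname{sn}(u)=\sin(\operatorname{am}(u))$, $\operatorname{cn}(u)=\cos(\operatorname{am}(u))$, $\operatorname{dn}(u)=\frac{d}{du}\operatorname{am}(u)$. The modulus $k=k_r$ ($r>0$) is the singular modulus: $k_r^2$ is the solution $t$ of $K(1-t)/K(t)=\sqrt r$, where $K(t)=\frac{\pi}{2}\,{}_2F_1(\frac12,\frac12;1;t)$ and ${}_2F_1$ is the Gauss hypergeometric function. $\operatorname{sn}^{(-1)}(\cdot,m)$ and $\operatorname{dn}^{(-1)}(\cdot,m)$ are the inverse functions of $\operatorname{sn}(\cdot,m)$ and $\operatorname{dn}(\cdot,m)$, written through $F[\varphi,m]=\int_0^{\varphi}\frac{d\theta}{\sqrt{1-m\sin^2\theta}}$ (incomplete elliptic integral of the first kind) as $\operatorname{sn}^{(-1)}(h,m)=F[\arcsin(h),m]$ and $\operatorname{dn}^{(-1)}(x,m)=F\left[\arcsin\sqrt{(1-x^2)/m},\,m\right]$. The relation between $x$ and $\operatorname{sn}(u)$ is taken in general to be $\operatorname{sn}(u)=\sqrt{1-x^2}/k$.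
   Formalization: The equivalence is for real 0<Y<1 and √(1-Y²)≤x<1; with principal sn^(-1) (-1≤h≤1), "root ⇒ ratio 3" is stated only if 3·dn^(-1)(x,Y²)≤F[π/2,Y²] (it fails beyond), the converse without that bound; the full equivalence allows any v with sn(v,m_0)=h as sn^(-1)(h,m_0). *)

theory Defs
  imports "HOL-Analysis.Analysis"
begin

section \<open>Elliptic integrals and Jacobi elliptic functions\<close>

text \<open>
  All quantities are real and the second argument \<open>m\<close> is always the parameter \<open>m = k^2\<close>,
  not the modulus \<open>k\<close>.
\<close>

definition ellF :: "real \<Rightarrow> real \<Rightarrow> real" where
  "ellF \<phi> m = (LBINT \<theta>=0..\<phi>. 1 / sqrt (1 - m * (sin \<theta>)\<^sup>2))"

text \<open>
  For \<open>0 \<le> m < 1\<close> the map \<open>\<lambda>\<phi>. ellF \<phi> m\<close> is a bijection of the reals, so the amplitude is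
  well defined.
\<close>

definition jacobi_am :: "real \<Rightarrow> real \<Rightarrow> real" where
  "jacobi_am u m = (THE \<phi>. u = ellF \<phi> m)"

definition jacobi_sn :: "real \<Rightarrow> real \<Rightarrow> real" where
  "jacobi_sn u m = sin (jacobi_am u m)"

definition jacobi_dn :: "real \<Rightarrow> real \<Rightarrow> real" where
  "jacobi_dn u m = deriv (\<lambda>v. jacobi_am v m) u"

definition sn_inv :: "real \<Rightarrow> real \<Rightarrow> real" where
  "sn_inv h m = ellF (arcsin h) m"

definition dn_inv :: "real \<Rightarrow> real \<Rightarrow> real" where
  "dn_inv x m = ellF (arcsin (sqrt ((1 - x\<^sup>2) / m))) m"

section \<open>The singular modulus\<close>

definition hyp2F1 :: "real \<Rightarrow> real \<Rightarrow> real \<Rightarrow> real \<Rightarrow> real" where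
  "hyp2F1 a b c z = eval_fps (fps_hypergeo [a, b] [c] 1) z"

definition ellK :: "real \<Rightarrow> real" where
  "ellK t = pi / 2 * hyp2F1 (1 / 2) (1 / 2) 1 t"

definition singular_modulus :: "real \<Rightarrow> real" where
  "singular_modulus r = sqrt (THE t. 0 < t \<and> t < 1 \<and> ellK (1 - t) / ellK t = sqrt r)"

section \<open>The quintic\<close>

definition coeff_e :: "real \<Rightarrow> real" where
  "coeff_e x = sqrt (1 - x\<^sup>2) * (1 - 4 * x^2 + 6 * x^4 - 4 * x^6 + x^8)"

definition coeff_d :: "real \<Rightarrow> real" where
  "coeff_d x = 1 - 6 * x^4 + 8 * x^6 - 3 * x^8"

definition coeff_c :: "real \<Rightarrow> real" where
  "coeff_c x = sqrt (1 - x\<^sup>2) * (- 2 + 8 * x^2 - 6 * x^4)"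

definition coeff_b :: "real \<Rightarrow> real" where
  "coeff_b x = - 2 + 6 * x^4 - 4 * x^6"

definition coeff_a :: "real \<Rightarrow> real" where
  "coeff_a x = (1 - 4 * x^2) * sqrt (1 - x\<^sup>2)"

definition quintic :: "real \<Rightarrow> real \<Rightarrow> real \<Rightarrow> real" where
  "quintic h x Y =
     coeff_e x + h * coeff_d x * Y + coeff_c x * Y^2 + h * coeff_b x * Y^3 + coeff_a x * Y^4
     + h * Y^5"

end

(*
  If s = sn u and sqrt (1 - x^2) = Y s, then quintic h x Y = Y^5 (h D - N), where N / D is the
  rational function of s that expresses sn (3u) for the parameter Y^2. The denominator
  D = (1 - Y^2 s^4)^2 (1 - Y^2 s^2 sn(2u)^2) is positive for real u, so the quintic vanishes exactly
  when h = sn (3u). Inverting sn on the first quarter period turns this into the quotient condition.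
*)
theory Submission
  imports Defs
begin

section \<open>Elliptic functions for a parameter in [0,1)\<close>

abbreviation jacobi_cn :: "real \<Rightarrow> real \<Rightarrow> real" where
  "jacobi_cn u m \<equiv> cos (jacobi_am u m)"

section \<open>The incomplete integral and the amplitude as its inverse\<close>

lemma one_minus_sin_squared_pos:
  fixes m :: real
  assumes "0 \<le> m" "m < 1"
  shows "0 < 1 - m * (sin t)\<^sup>2"
proof -
  have "m * (sin t)\<^sup>2 \<le> m * 1"
    using assms by (intro mult_left_mono) (auto simp: abs_square_le_1)
  then show ?thesis using assms by simp
qed

lemma DERIV_ellF:
  assumes "0 \<le> m" "m < 1"
  shows "((\<lambda>p. ellF p m) has_real_derivative 1 / sqrt (1 - m * (sin p)\<^sup>2)) (at p)"
proof -
  let ?f = "\<lambda>t. 1 / sqrt (1 - m * (sin t)\<^sup>2)"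
  \<comment> \<open>The margin 1 makes \<open>p\<close> an interior point of an interval that also
    contains 0, so the one-sided \<open>within\<close> derivative becomes a full one.\<close>
  let ?a = "- \<bar>p\<bar> - 1" and ?b = "\<bar>p\<bar> + 1"
  have "continuous_on {?a..?b} ?f"
    using one_minus_sin_squared_pos[OF assms] by (intro continuous_intros) (auto simp: less_le)
  then have "((\<lambda>u. LBINT y=0..u. ?f y) has_vector_derivative ?f p) (at p within {?a..?b})"
    using interval_integral_FTC2[of ?a 0 ?b ?f p] by (auto simp: zero_ereal_def)
  then have "((\<lambda>u. LBINT y=0..u. ?f y) has_vector_derivative ?f p) (at p)"
    by (subst (asm) at_within_interior) auto
  then show ?thesis
    by (simp add: ellF_def has_real_derivative_iff_has_vector_derivative)
qed

lemma ellF_0 [simp]: "ellF 0 m = 0"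
  by (simp add: ellF_def zero_ereal_def[symmetric])

lemma DERIV_ellF_ge_1:
  fixes m :: real
  assumes "0 \<le> m" "m < 1"
  shows "1 \<le> 1 / sqrt (1 - m * (sin p)\<^sup>2)"
  using one_minus_sin_squared_pos[OF assms, of p] assms(1) by simp

text \<open>The integrand is at least 1, so \<open>ellF p m - p\<close> is nondecreasing in
  \<open>p\<close>. This linear growth yields both injectivity and surjectivity, hence a
  well-defined amplitude.\<close>

lemma ellF_diff_ge:
  assumes "0 \<le> m" "m < 1" "p \<le> q"
  shows "q - p \<le> ellF q m - ellF p m"
proof -
  have "ellF p m - p \<le> ellF q m - q"
  proof (rule DERIV_nonneg_imp_nondecreasing[OF assms(3)])
    fix x
    have "((\<lambda>p. ellF p m - p) has_real_derivative 1 / sqrt (1 - m * (sin x)\<^sup>2) - 1) (at x)"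
      by (intro DERIV_diff DERIV_ellF assms DERIV_ident)
    then show "\<exists>y. ((\<lambda>p. ellF p m - p) has_real_derivative y) (at x) \<and> 0 \<le> y"
      using DERIV_ellF_ge_1[OF assms(1,2), of x] by (metis diff_ge_0_iff_ge)
  qed
  then show ?thesis by simp
qed

lemma ellF_strict_mono:
  assumes "0 \<le> m" "m < 1" "p < q"
  shows "ellF p m < ellF q m"
  using ellF_diff_ge[of m p q] assms by simp

text \<open>Linear growth away from \<open>ellF 0 m = 0\<close> brackets \<open>u\<close> between
  the values at the points \<open>-\<bar>u\<bar>\<close> and \<open>\<bar>u\<bar>\<close>;
  continuity does the rest.\<close>

lemma ellF_surj:
  assumes "0 \<le> m" "m < 1"
  shows "\<exists>p. ellF p m = u"
proof -
  have "ellF (- \<bar>u\<bar>) m \<le> u" "u \<le> ellF \<bar>u\<bar> m"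
    using ellF_diff_ge[of m "- \<bar>u\<bar>" 0] ellF_diff_ge[of m 0 "\<bar>u\<bar>"] assms by auto
  then have "\<exists>p\<ge>-\<bar>u\<bar>. p \<le> \<bar>u\<bar> \<and> ellF p m = u"
    using DERIV_isCont[OF DERIV_ellF[OF assms]] by (intro IVT) auto
  then show ?thesis by blast
qed

lemma jacobi_am_ellF:
  assumes "0 \<le> m" "m < 1"
  shows "jacobi_am (ellF p m) m = p"
  unfolding jacobi_am_def
  using ellF_strict_mono[OF assms] by (intro the_equality) (auto, metis linorder_neqE less_irrefl)

lemma ellF_jacobi_am:
  assumes "0 \<le> m" "m < 1"
  shows "ellF (jacobi_am u m) m = u"
  using ellF_surj[OF assms, of u] jacobi_am_ellF[OF assms] by auto

lemma jacobi_am_0: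
  assumes "0 \<le> m" "m < 1"
  shows "jacobi_am 0 m = 0"
  using jacobi_am_ellF[OF assms, of 0] by simp

text \<open>Inverse function rule applied to \<open>ellF\<close>; it requires continuity of the
  inverse, which is established first. The value of the derivative is what identifies
  \<open>jacobi_dn\<close> below.\<close>

lemma DERIV_jacobi_am:
  assumes "0 \<le> m" "m < 1"
  shows "((\<lambda>u. jacobi_am u m) has_real_derivative sqrt (1 - m * (sin (jacobi_am u m))\<^sup>2)) (at u)"
proof -
  let ?p = "jacobi_am u m"
  have "isCont (\<lambda>u. jacobi_am u m) (ellF ?p m)"
    by (rule isCont_inverse_function[where d=1 and f="\<lambda>p. ellF p m"])
      (simp_all add: jacobi_am_ellF assms DERIV_isCont[OF DERIV_ellF])
  then have cont: "isCont (\<lambda>u. jacobi_am u m) u"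
    by (simp add: ellF_jacobi_am assms)
  have "((\<lambda>u. jacobi_am u m) has_real_derivative inverse (1 / sqrt (1 - m * (sin ?p)\<^sup>2))) (at u)"
  proof (rule DERIV_inverse_function[where f="\<lambda>p. ellF p m" and a="u-1" and b="u+1"])
    show "1 / sqrt (1 - m * (sin ?p)\<^sup>2) \<noteq> 0"
      using one_minus_sin_squared_pos[OF assms, of ?p] by simp
  qed (simp_all add: DERIV_ellF ellF_jacobi_am assms cont)
  then show ?thesis by simp
qed

section \<open>Algebraic relations and derivatives of sn, cn and dn\<close>

lemma jacobi_dn_eq:
  assumes "0 \<le> m" "m < 1"
  shows "jacobi_dn u m = sqrt (1 - m * (jacobi_sn u m)\<^sup>2)"
  unfolding jacobi_dn_def jacobi_sn_def by (rule DERIV_imp_deriv[OF DERIV_jacobi_am[OF assms]])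

lemma jacobi_dn_pos:
  assumes "0 \<le> m" "m < 1"
  shows "0 < jacobi_dn u m"
  unfolding jacobi_dn_eq[OF assms] jacobi_sn_def using one_minus_sin_squared_pos[OF assms] by simp

lemma jacobi_dn_squared:
  assumes "0 \<le> m" "m < 1"
  shows "(jacobi_dn u m)\<^sup>2 = 1 - m * (jacobi_sn u m)\<^sup>2"
  unfolding jacobi_dn_eq[OF assms] jacobi_sn_def
  using one_minus_sin_squared_pos[OF assms, of "jacobi_am u m"] by simp

lemma jacobi_cn_squared: "(jacobi_cn u m)\<^sup>2 = 1 - (jacobi_sn u m)\<^sup>2"
  by (simp add: jacobi_sn_def cos_squared_eq)

lemma DERIV_jacobi_am_dn:
  assumes "0 \<le> m" "m < 1"
  shows "((\<lambda>u. jacobi_am u m) has_real_derivative jacobi_dn u m) (at u)"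
  using DERIV_jacobi_am[OF assms] by (simp add: jacobi_dn_eq[OF assms] jacobi_sn_def)

lemma DERIV_jacobi_sn:
  assumes "0 \<le> m" "m < 1"
  shows "((\<lambda>u. jacobi_sn u m) has_real_derivative jacobi_cn u m * jacobi_dn u m) (at u)"
  unfolding jacobi_sn_def
  by (rule derivative_eq_intros DERIV_jacobi_am_dn[OF assms] refl | simp)+

lemma DERIV_jacobi_cn:
  assumes "0 \<le> m" "m < 1"
  shows "((\<lambda>u. jacobi_cn u m) has_real_derivative - jacobi_sn u m * jacobi_dn u m) (at u)"
  by (rule derivative_eq_intros DERIV_jacobi_am_dn[OF assms] refl | simp add: jacobi_sn_def)+

lemma DERIV_jacobi_dn:
  assumes "0 \<le> m" "m < 1"
  shows "((\<lambda>u. jacobi_dn u m) has_real_derivative - m * jacobi_sn u m * jacobi_cn u m) (at u)"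
proof -
  have pos: "0 < 1 - m * (jacobi_sn u m)\<^sup>2"
    unfolding jacobi_sn_def by (rule one_minus_sin_squared_pos[OF assms])
  have "((\<lambda>u. sqrt (1 - m * (jacobi_sn u m)\<^sup>2)) has_real_derivative
      (- m * (2 * jacobi_sn u m * (jacobi_cn u m * jacobi_dn u m))) * (inverse (sqrt (1 - m * (jacobi_sn u m)\<^sup>2)) / 2)) (at u)"
    by (rule derivative_eq_intros DERIV_jacobi_sn[OF assms] refl | use pos in simp)+
  also have "(- m * (2 * jacobi_sn u m * (jacobi_cn u m * jacobi_dn u m))) * (inverse (sqrt (1 - m * (jacobi_sn u m)\<^sup>2)) / 2)
      = - m * jacobi_sn u m * jacobi_cn u m"
    using jacobi_dn_pos[OF assms, of u] by (simp add: jacobi_dn_eq[OF assms, symmetric] field_simps)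
  finally show ?thesis
    by (simp add: jacobi_dn_eq[OF assms])
qed

lemma jacobi_at_0:
  assumes "0 \<le> m" "m < 1"
  shows "jacobi_sn 0 m = 0" "jacobi_cn 0 m = 1" "jacobi_dn 0 m = 1"
  by (simp_all add: jacobi_dn_eq jacobi_sn_def jacobi_am_0 assms)

section \<open>Addition theorem for sn, cn and dn\<close>

lemma addition_denominator_pos:
  fixes m :: real
  assumes "0 \<le> m" "m < 1"
  shows "0 < 1 - m * (jacobi_sn u m)\<^sup>2 * (jacobi_sn v m)\<^sup>2"
proof -
  have "(jacobi_sn v m)\<^sup>2 \<le> 1" by (simp add: jacobi_sn_def abs_square_le_1)
  then have "m * (jacobi_sn u m)\<^sup>2 * (jacobi_sn v m)\<^sup>2 \<le> m * (jacobi_sn u m)\<^sup>2 * 1"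
    using assms by (intro mult_left_mono) auto
  moreover have "0 < 1 - m * (jacobi_sn u m)\<^sup>2"
    unfolding jacobi_sn_def by (rule one_minus_sin_squared_pos[OF assms])
  ultimately show ?thesis by simp
qed

text \<open>Cross-multiplied quotient rule: constancy of each addition quotient reduces to a
  polynomial identity in the values of sn, cn and dn.\<close>

lemma DERIV_quotient_zero:
  fixes N D :: "real \<Rightarrow> real"
  assumes "(N has_real_derivative N') (at t)" "(D has_real_derivative D') (at t)"
    and "D t \<noteq> 0" "N' * D t = N t * D'"
  shows "((\<lambda>t. N t / D t) has_real_derivative 0) (at t)"
  using DERIV_divide[OF assms(1,2,3)] assms(4) by simp

text \<open>Along \<open>(t, c - t)\<close> the right-hand sides of the addition formulas have derivative zero,
  so their value at \<open>t = u\<close>, \<open>c = u + v\<close> agrees with the one at \<open>t = u + v\<close>.\<close>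

lemma jacobi_addition:
  fixes m u v :: real
  assumes m: "0 \<le> m" "m < 1"
  defines "s1 \<equiv> jacobi_sn u m" and "c1 \<equiv> jacobi_cn u m" and "d1 \<equiv> jacobi_dn u m"
    and "s2 \<equiv> jacobi_sn v m" and "c2 \<equiv> jacobi_cn v m" and "d2 \<equiv> jacobi_dn v m"
  shows jacobi_sn_add: "jacobi_sn (u + v) m = (s1 * c2 * d2 + s2 * c1 * d1) / (1 - m * s1\<^sup>2 * s2\<^sup>2)"
    and jacobi_cn_add: "jacobi_cn (u + v) m = (c1 * c2 - s1 * s2 * d1 * d2) / (1 - m * s1\<^sup>2 * s2\<^sup>2)"
    and jacobi_dn_add: "jacobi_dn (u + v) m = (d1 * d2 - m * s1 * s2 * c1 * c2) / (1 - m * s1\<^sup>2 * s2\<^sup>2)"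
proof -
  define w where "w = u + v"
  let ?S = "\<lambda>t. jacobi_sn t m" and ?C = "\<lambda>t. jacobi_cn t m" and ?D = "\<lambda>t. jacobi_dn t m"
  define Q where "Q = (\<lambda>t. 1 - m * (?S t)\<^sup>2 * (?S (w - t))\<^sup>2)"
  define A where "A = (\<lambda>t. ?S t * ?C (w - t) * ?D (w - t) + ?S (w - t) * ?C t * ?D t)"
  define B where "B = (\<lambda>t. ?C t * ?C (w - t) - ?S t * ?S (w - t) * ?D t * ?D (w - t))"
  define E where "E = (\<lambda>t. ?D t * ?D (w - t) - m * ?S t * ?S (w - t) * ?C t * ?C (w - t))"
  have refl_deriv: "((\<lambda>t. f (w - t)) has_real_derivative - f') (at t)"
    if "(f has_real_derivative f') (at (w - t))" for f f' t
  proof -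
    have "((\<lambda>t. w - t) has_real_derivative -1) (at t)"
      by (auto intro!: derivative_eq_intros)
    from DERIV_chain2[where f=f and g="\<lambda>t. w - t", OF that this] show ?thesis by simp
  qed
  note der = DERIV_jacobi_sn[OF m] DERIV_jacobi_cn[OF m] DERIV_jacobi_dn[OF m]
    refl_deriv[OF DERIV_jacobi_sn[OF m]] refl_deriv[OF DERIV_jacobi_cn[OF m]]
    refl_deriv[OF DERIV_jacobi_dn[OF m]]
  have const: "A u / Q u = A w / Q w \<and> B u / Q u = B w / Q w \<and> E u / Q u = E w / Q w"
  proof -
    have zero: "((\<lambda>t. A t / Q t) has_real_derivative 0) (at t) \<and>
        ((\<lambda>t. B t / Q t) has_real_derivative 0) (at t) \<and>
        ((\<lambda>t. E t / Q t) has_real_derivative 0) (at t)" for t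
    proof -
      define s c d s' c' d' where defs: "s = ?S t" "c = ?C t" "d = ?D t"
        "s' = ?S (w - t)" "c' = ?C (w - t)" "d' = ?D (w - t)"
      have sq: "c\<^sup>2 = 1 - s\<^sup>2" "d\<^sup>2 = 1 - m * s\<^sup>2" "c'\<^sup>2 = 1 - s'\<^sup>2" "d'\<^sup>2 = 1 - m * s'\<^sup>2"
        unfolding defs by (simp_all add: jacobi_cn_squared jacobi_dn_squared m)
      have Q0: "Q t \<noteq> 0"
        using addition_denominator_pos[OF m, of t "w - t"] by (simp add: Q_def)
      have dQ: "(Q has_real_derivative - 2 * m * s * s' * (s' * c * d - s * c' * d')) (at t)"
        unfolding Q_def
        by (rule derivative_eq_intros der refl)+ (simp add: defs algebra_simps power2_eq_square)
      have dA: "(A has_real_derivative s * s' * ((d'\<^sup>2 + m * c'\<^sup>2) - (d\<^sup>2 + m * c\<^sup>2))) (at t)"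
        unfolding A_def
        by (rule derivative_eq_intros der refl)+ (simp add: defs algebra_simps power2_eq_square)
      have dB: "(B has_real_derivative
          c * s' * d' * (1 - d\<^sup>2 + m * s\<^sup>2) - c' * s * d * (1 - d'\<^sup>2 + m * s'\<^sup>2)) (at t)"
        unfolding B_def
        by (rule derivative_eq_intros der refl)+ (simp add: defs algebra_simps power2_eq_square)
      have dE: "(E has_real_derivative
          m * (s' * c' * d * (1 - c\<^sup>2 + s\<^sup>2) - s * c * d' * (1 - c'\<^sup>2 + s'\<^sup>2))) (at t)"
        unfolding E_def
        by (rule derivative_eq_intros der refl)+ (simp add: defs algebra_simps power2_eq_square)
      let ?q = "1 - m * s\<^sup>2 * s'\<^sup>2" and ?r = "- 2 * m * s * s' * (s' * c * d - s * c' * d')"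
      have "((\<lambda>t. A t / Q t) has_real_derivative 0) (at t)"
      proof (rule DERIV_quotient_zero[OF dA dQ Q0])
        \<comment> \<open>Numerator and last factor of \<open>?r\<close> are the sum and the
          difference of \<open>s * c' * d'\<close> and \<open>s' * c * d\<close>, so only even
          powers of \<open>c\<close>, \<open>d\<close>, \<open>c'\<close>, \<open>d'\<close> remain
          and \<open>sq\<close> eliminates them.\<close>
        have "(s * c' * d' + s' * c * d) * ?r = 2 * m * s * s' * (s\<^sup>2 * (c'\<^sup>2 * d'\<^sup>2) - s'\<^sup>2 * (c\<^sup>2 * d\<^sup>2))"
          by (simp add: algebra_simps power2_eq_square)
        also have "s\<^sup>2 * (c'\<^sup>2 * d'\<^sup>2) - s'\<^sup>2 * (c\<^sup>2 * d\<^sup>2) = (s\<^sup>2 - s'\<^sup>2) * ?q"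
          unfolding sq by (simp add: algebra_simps)
        finally show "s * s' * ((d'\<^sup>2 + m * c'\<^sup>2) - (d\<^sup>2 + m * c\<^sup>2)) * Q t = A t * ?r"
          unfolding A_def Q_def defs[symmetric] sq by (simp add: algebra_simps)
      qed
      moreover have "((\<lambda>t. B t / Q t) has_real_derivative 0) (at t)"
      proof (rule DERIV_quotient_zero[OF dB dQ Q0])
        \<comment> \<open>Grouped by the two monomials \<open>s * c * d'\<close> and
          \<open>s' * c' * d\<close> that make up the derivative of \<open>B\<close>; each bracket
          then collapses to the denominator \<open>?q\<close>. The case of \<open>E\<close> follows
          the same pattern.\<close>
        have "(c * c' - s * s' * d * d') * ?r = 2 * m * s * s' *
            (s * c * d' * (c'\<^sup>2 + s'\<^sup>2 * d\<^sup>2) - s' * c' * d * (c\<^sup>2 + s\<^sup>2 * d'\<^sup>2))"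
          by (simp add: algebra_simps power2_eq_square)
        also have "c'\<^sup>2 + s'\<^sup>2 * d\<^sup>2 = ?q"
          unfolding sq by (simp add: algebra_simps)
        also have "c\<^sup>2 + s\<^sup>2 * d'\<^sup>2 = ?q"
          unfolding sq by (simp add: algebra_simps)
        finally show "(c * s' * d' * (1 - d\<^sup>2 + m * s\<^sup>2) - c' * s * d * (1 - d'\<^sup>2 + m * s'\<^sup>2)) * Q t = B t * ?r"
          unfolding B_def Q_def defs[symmetric] sq by (simp add: algebra_simps power2_eq_square)
      qed
      moreover have "((\<lambda>t. E t / Q t) has_real_derivative 0) (at t)"
      proof (rule DERIV_quotient_zero[OF dE dQ Q0])
        have "(d * d' - m * s * s' * c * c') * ?r = 2 * m * s * s' *
            (s * c' * d * (d'\<^sup>2 + m * s'\<^sup>2 * c\<^sup>2) - s' * c * d' * (d\<^sup>2 + m * s\<^sup>2 * c'\<^sup>2))"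
          by (simp add: algebra_simps power2_eq_square)
        also have "d'\<^sup>2 + m * s'\<^sup>2 * c\<^sup>2 = ?q"
          unfolding sq by (simp add: algebra_simps)
        also have "d\<^sup>2 + m * s\<^sup>2 * c'\<^sup>2 = ?q"
          unfolding sq by (simp add: algebra_simps)
        finally show "m * (s' * c' * d * (1 - c\<^sup>2 + s\<^sup>2) - s * c * d' * (1 - c'\<^sup>2 + s'\<^sup>2)) * Q t = E t * ?r"
          unfolding E_def Q_def defs[symmetric] sq by (simp add: algebra_simps power2_eq_square)
      qed
      ultimately show ?thesis by blast
    qed
    show ?thesis
      using DERIV_isconst_all[of "\<lambda>t. A t / Q t" u w] DERIV_isconst_all[of "\<lambda>t. B t / Q t" u w]
        DERIV_isconst_all[of "\<lambda>t. E t / Q t" u w] zero by blast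
  qed
  \<comment> \<open>At \<open>t = w\<close> the second argument is 0, where sn vanishes and cn and
    dn equal 1, so each quotient is the function itself at \<open>u + v\<close>.\<close>
  have at_w: "A w = ?S w" "B w = ?C w" "E w = ?D w" "Q w = 1"
    by (simp_all add: A_def B_def E_def Q_def jacobi_at_0 m)
  have at_u: "A u = s1 * c2 * d2 + s2 * c1 * d1" "B u = c1 * c2 - s1 * s2 * d1 * d2"
    "E u = d1 * d2 - m * s1 * s2 * c1 * c2" "Q u = 1 - m * s1\<^sup>2 * s2\<^sup>2"
    by (simp_all add: A_def B_def E_def Q_def w_def s1_def c1_def d1_def s2_def c2_def d2_def)
  show "jacobi_sn (u + v) m = (s1 * c2 * d2 + s2 * c1 * d1) / (1 - m * s1\<^sup>2 * s2\<^sup>2)"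
    "jacobi_cn (u + v) m = (c1 * c2 - s1 * s2 * d1 * d2) / (1 - m * s1\<^sup>2 * s2\<^sup>2)"
    "jacobi_dn (u + v) m = (d1 * d2 - m * s1 * s2 * c1 * c2) / (1 - m * s1\<^sup>2 * s2\<^sup>2)"
    using const unfolding at_w at_u by (simp_all add: w_def)
qed

section \<open>The singular modulus is well defined\<close>

text \<open>These are the squares of \<open>(2n choose n) / 4^n\<close>, the Taylor coefficients of
  \<open>2 / pi * ellK t\<close>.\<close>

definition ellK_coeff :: "nat \<Rightarrow> real" where
  "ellK_coeff n = fps_nth (fps_hypergeo [1 / 2, 1 / 2] [1] 1) n"

lemma ellK_coeff_0: "ellK_coeff 0 = 1"
  by (simp add: ellK_coeff_def)

lemma ellK_coeff_Suc:
  "ellK_coeff (Suc n) = ((1 / 2 + real n) / (1 + real n))\<^sup>2 * ellK_coeff n"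
  unfolding ellK_coeff_def fps_hypergeo_rec by (simp add: power2_eq_square)

lemma ellK_coeff_pos: "0 < ellK_coeff n"
proof (induction n)
  case (Suc n)
  have "0 < (1 / 2 + real n) / (1 + real n)" by (intro divide_pos_pos) auto
  with Suc show ?case unfolding ellK_coeff_Suc by simp
qed (simp add: ellK_coeff_0)

lemma ellK_coeff_le_1: "ellK_coeff n \<le> 1"
proof (induction n)
  case (Suc n)
  have "((1 / 2 + real n) / (1 + real n))\<^sup>2 \<le> 1"
    by (intro power_le_one) auto
  with Suc ellK_coeff_pos[of n] show ?case
    unfolding ellK_coeff_Suc by (intro mult_le_one) (auto simp: less_imp_le)
qed (simp add: ellK_coeff_0)

text \<open>Successive coefficients shrink no faster than successive harmonic terms, because
  \<open>(1 + x) * (2 + x)\<close> falls short of \<open>(3 / 2 + x)^2\<close> by 1/4. The factor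
  1/4 in the bound is \<open>ellK_coeff 1\<close>, giving equality in the base case.\<close>

lemma ellK_coeff_ge: "inverse (real (Suc n)) / 4 \<le> ellK_coeff (Suc n)"
proof (induction n)
  case (Suc n)
  define x where "x = real n"
  have x: "0 \<le> x" by (simp add: x_def)
  have "(1 + x) * (2 + x) \<le> (3 / 2 + x)\<^sup>2"
    by (simp add: power2_eq_square algebra_simps)
  then have "(1 + x) / (2 + x) \<le> ((3 / 2 + x) / (2 + x))\<^sup>2"
    using x by (simp add: power_divide divide_simps) (simp add: power2_eq_square algebra_simps)
  then have "(1 + x) / (2 + x) * (inverse (1 + x) / 4) \<le> ((3 / 2 + x) / (2 + x))\<^sup>2 * ellK_coeff (Suc n)"
    using Suc x by (intro mult_mono) (auto simp: x_def)
  moreover have "(1 + x) / (2 + x) * (inverse (1 + x) / 4) = inverse (real (Suc (Suc n))) / 4"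
  proof -
    have "real (Suc (Suc n)) = 2 + x" by (simp add: x_def)
    then show ?thesis using x by (simp add: divide_simps) (simp add: algebra_simps)
  qed
  moreover have "((3 / 2 + x) / (2 + x))\<^sup>2 * ellK_coeff (Suc n) = ellK_coeff (Suc (Suc n))"
    by (subst (2) ellK_coeff_Suc) (simp add: x_def add.commute add.left_commute)
  ultimately show ?case by (simp only:)
qed (simp add: ellK_coeff_Suc ellK_coeff_0 power2_eq_square)

text \<open>The coefficients dominate the harmonic series, so the elliptic integral \<open>ellK\<close> tends to
  infinity at 1 and the ratio \<open>ellK (1 - t) / ellK t\<close> takes every positive value.\<close>

lemma not_summable_ellK_coeff: "\<not> summable ellK_coeff"
proof
  assume "summable ellK_coeff"
  then have "summable (\<lambda>n. ellK_coeff (Suc n))" by (simp add: summable_Suc_iff)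
  then have "summable (\<lambda>n. inverse (real (Suc n)) / 4)"
    by (rule summable_comparison_test'[where N=0]) (use ellK_coeff_ge in auto)
  then have "summable (\<lambda>n. inverse (real (Suc n)))"
    by (simp only: summable_divide_iff) simp
  then have "summable (\<lambda>n. inverse (real n))" by (subst (asm) summable_Suc_iff)
  then show False using not_summable_harmonic[where ?'a = real] by simp
qed

section \<open>Positivity, monotonicity, continuity and unboundedness of K\<close>

lemma summable_ellK_coeff:
  assumes "\<bar>t\<bar> < 1"
  shows "summable (\<lambda>n. ellK_coeff n * t ^ n)"
proof (rule summable_comparison_test'[where N=0])
  show "summable (\<lambda>n. \<bar>t\<bar> ^ n)" using assms by (intro summable_geometric) auto
  show "norm (ellK_coeff n * t ^ n) \<le> \<bar>t\<bar> ^ n" for n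
    using mult_right_mono[OF ellK_coeff_le_1[of n], of "\<bar>t\<bar> ^ n"] ellK_coeff_pos[of n]
    by (simp add: abs_mult power_abs)
qed

lemma ellK_eq_suminf: "ellK t = pi / 2 * (\<Sum>n. ellK_coeff n * t ^ n)"
  by (simp only: ellK_def hyp2F1_def eval_fps_def ellK_coeff_def)

lemma sum_le_ellK:
  assumes "0 \<le> t" "t < 1"
  shows "pi / 2 * (\<Sum>n<N. ellK_coeff n * t ^ n) \<le> ellK t"
  unfolding ellK_eq_suminf
  using assms ellK_coeff_pos
  by (intro mult_left_mono sum_le_suminf summable_ellK_coeff) (auto simp: less_imp_le)

lemma ellK_pos:
  assumes "0 \<le> t" "t < 1"
  shows "0 < ellK t"
  using sum_le_ellK[OF assms, of 1] pi_gt_zero by (simp add: ellK_coeff_0 del: pi_gt_zero)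

lemma ellK_strict_mono:
  assumes "0 \<le> s" "s < t" "t < 1"
  shows "ellK s < ellK t"
proof -
  have "0 < (\<Sum>n. ellK_coeff n * t ^ n - ellK_coeff n * s ^ n)"
  \<comment> \<open>The constant terms cancel, so strictness has to come from the linear
    term.\<close>
  proof (rule suminf_pos2[where i=1])
    show "summable (\<lambda>n. ellK_coeff n * t ^ n - ellK_coeff n * s ^ n)"
      using assms by (intro summable_diff summable_ellK_coeff) auto
    show "0 \<le> ellK_coeff n * t ^ n - ellK_coeff n * s ^ n" for n
      using assms ellK_coeff_pos[of n] by (simp add: power_mono)
    show "0 < ellK_coeff 1 * t ^ 1 - ellK_coeff 1 * s ^ 1"
      using assms ellK_coeff_pos[of 1] by simp
  qed
  then show ?thesis
    unfolding ellK_eq_suminf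
    using assms by (subst (asm) suminf_diff[symmetric]) (auto intro!: summable_ellK_coeff)
qed

lemma isCont_ellK:
  assumes "\<bar>t\<bar> < 1"
  shows "isCont ellK t"
proof -
  obtain K where K: "\<bar>t\<bar> < K" "K < 1" using assms dense by blast
  have "isCont (\<lambda>t. \<Sum>n. ellK_coeff n * t ^ n) t"
    by (rule isCont_powser[where K=K]) (use K in \<open>auto intro!: summable_ellK_coeff\<close>)
  then have "isCont (\<lambda>t. pi / 2 * (\<Sum>n. ellK_coeff n * t ^ n)) t"
    by (intro continuous_intros)
  then show ?thesis by (simp add: ellK_eq_suminf[abs_def])
qed

text \<open>By divergence of the coefficient sum, some partial sum at 1 exceeds the required bound.
  It is a polynomial, so it still does so just left of 1, where it bounds \<open>ellK\<close> from
  below.\<close>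

lemma ellK_unbounded:
  assumes "a < 1"
  shows "\<exists>t. a < t \<and> 0 < t \<and> t < 1 \<and> B < ellK t"
proof -
  have "\<exists>N. 2 / pi * B < (\<Sum>n<N. ellK_coeff n)"
  proof (rule ccontr)
    assume "\<nexists>N. 2 / pi * B < (\<Sum>n<N. ellK_coeff n)"
    then have "summable ellK_coeff"
      using ellK_coeff_pos
      by (intro bounded_imp_summable[where B="2 / pi * B"])
        (auto simp: less_imp_le not_less simp del: sum.lessThan_Suc simp flip: lessThan_Suc_atMost)
    with not_summable_ellK_coeff show False by blast
  qed
  then obtain N where N: "2 / pi * B < (\<Sum>n<N. ellK_coeff n)" by blast
  let ?p = "\<lambda>t. pi / 2 * (\<Sum>n<N. ellK_coeff n * t ^ n)"
  have "(?p \<longlongrightarrow> ?p 1) (at_left 1)"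
    by (intro tendsto_intros)
  moreover have "B < ?p 1" using N by (simp add: field_simps)
  ultimately have "eventually (\<lambda>t. B < ?p t) (at_left 1)"
    by (rule order_tendstoD)
  moreover have "eventually (\<lambda>t. t \<in> {max a 0<..<1}) (at_left 1)"
    using assms by (intro eventually_at_left_real) auto
  ultimately have "eventually (\<lambda>t. B < ?p t \<and> t \<in> {max a 0<..<1}) (at_left 1)"
    by (rule eventually_conj)
  then obtain t where t: "B < ?p t" "t \<in> {max a 0<..<1}"
    using eventually_happens'[of "at_left (1::real)"] by (auto simp: trivial_limit_at_left_real)
  then have "B < ellK t" using sum_le_ellK[of t N] by auto
  with t show ?thesis by auto
qed

section \<open>The ratio K(1-t)/K(t) as a bijection from (0,1) to the positive reals\<close>

definition ellK_ratio :: "real \<Rightarrow> real" where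
  "ellK_ratio t = ellK (1 - t) / ellK t"

lemma ellK_ratio_strict_antimono:
  assumes "0 < s" "s < t" "t < 1"
  shows "ellK_ratio t < ellK_ratio s"
  unfolding ellK_ratio_def
  using assms ellK_pos[of s] ellK_pos[of "1 - t"] ellK_strict_mono[of s t] ellK_strict_mono[of "1 - t" "1 - s"]
  by (intro frac_less) auto

lemma ellK_ratio_unbounded: "\<exists>t. 0 < t \<and> t < 1 \<and> B < ellK_ratio t"
proof -
  \<comment> \<open>The witness will be \<open>1 - t\<close>, which swaps numerator and denominator.
    The condition \<open>1 / 2 < t\<close> bounds the new denominator \<open>ellK (1 - t)\<close> by
    \<open>ellK (1 / 2)\<close>; the absolute value covers negative \<open>B\<close>.\<close>
  obtain t where t: "1 / 2 < t" "t < 1" "\<bar>B\<bar> * ellK (1 / 2) < ellK t"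
    using ellK_unbounded[of "1 / 2" "\<bar>B\<bar> * ellK (1 / 2)"] by auto
  have K: "ellK (1 - t) < ellK (1 / 2)" "0 < ellK (1 - t)"
    using t by (auto intro!: ellK_strict_mono ellK_pos)
  have "B * ellK (1 - t) \<le> \<bar>B\<bar> * ellK (1 / 2)"
    using K by (intro mult_mono) auto
  then have "B < ellK_ratio (1 - t)"
    using t K by (simp add: ellK_ratio_def field_simps)
  with t show ?thesis by (intro exI[of _ "1 - t"]) auto
qed

lemma ellK_ratio_reflect: "ellK_ratio (1 - t) = 1 / ellK_ratio t"
  by (simp add: ellK_ratio_def)

text \<open>Large values occur by unboundedness, small ones by reflecting a point where the ratio
  exceeds \<open>1 / q\<close>; the intermediate value theorem fills the gap.\<close>

lemma ellK_ratio_surj: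
  assumes "0 < q"
  shows "\<exists>t. 0 < t \<and> t < 1 \<and> ellK_ratio t = q"
proof -
  obtain t1 where t1: "0 < t1" "t1 < 1" "q < ellK_ratio t1"
    using ellK_ratio_unbounded by blast
  obtain t2 where t2: "0 < t2" "t2 < 1" "1 / q < ellK_ratio t2"
    using ellK_ratio_unbounded by blast
  have "ellK_ratio (1 - t2) < q"
  proof -
    have "0 < ellK_ratio t2" using t2 assms by (meson less_trans zero_less_divide_1_iff)
    then show ?thesis
      unfolding ellK_ratio_reflect using t2(3) assms by (simp add: field_simps)
  qed
  note t2' = this
  have cont: "isCont ellK_ratio t" if "0 < t" "t < 1" for t
    unfolding ellK_ratio_def[abs_def]
    using that ellK_pos[of t]
    by (intro continuous_intros isCont_ellK isCont_o2[OF _ isCont_ellK, of _ "\<lambda>t. 1 - t"]) auto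
  \<comment> \<open>The ratio is decreasing, so the point with value above \<open>q\<close> lies to
    the left of the one with value below \<open>q\<close>.\<close>
  have "t1 \<le> 1 - t2"
    using ellK_ratio_strict_antimono[of "1 - t2" t1] t1 t2 t2' by force
  then have "\<exists>t\<ge>t1. t \<le> 1 - t2 \<and> ellK_ratio t = q"
    using t1 t2 t2' cont by (intro IVT2) auto
  then show ?thesis using t1 t2 by (metis diff_gt_0_iff_gt less_le_trans le_less_trans diff_less_eq less_add_same_cancel1)
qed

text \<open>The definite description says something only once its solution exists and is unique:
  surjectivity of the ratio gives the former, strict antitonicity the latter.\<close>

lemma singular_modulus_bounds:
  assumes "0 < r"
  shows "0 < singular_modulus r" "singular_modulus r < 1"
proof -
  have "\<exists>!t. 0 < t \<and> t < 1 \<and> ellK (1 - t) / ellK t = sqrt r"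
    using ellK_ratio_surj[of "sqrt r"] ellK_ratio_strict_antimono assms
    unfolding ellK_ratio_def by (metis linorder_neqE less_irrefl real_sqrt_gt_zero)
  from theI'[OF this] show "0 < singular_modulus r" "singular_modulus r < 1"
    by (simp_all add: singular_modulus_def)
qed

section \<open>Triplication and the quintic\<close>

text \<open>Numerator of the triplication formula for sn, as a polynomial in \<open>s = sn u\<close>
  with parameter \<open>m\<close>; \<open>triple_den\<close> is the matching denominator.\<close>

definition triple_num :: "real \<Rightarrow> real \<Rightarrow> real" where
  "triple_num m s = s * (3 - 4 * (1 + m) * s\<^sup>2 + 6 * m * s ^ 4 - m\<^sup>2 * s ^ 8)"

definition triple_den :: "real \<Rightarrow> real \<Rightarrow> real" where
  "triple_den m s = 1 - 6 * m * s ^ 4 + 4 * m * (1 + m) * s ^ 6 - 3 * m\<^sup>2 * s ^ 8"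

text \<open>The addition theorem is used for \<open>u + u\<close> and then for
  \<open>2 * u + u\<close>. Scaling by \<open>q^2\<close> clears the duplication denominators and
  leaves only even powers of \<open>c\<close> and \<open>d\<close>. The scaled denominator stays a
  product of positive factors.\<close>

lemma jacobi_sn_triple:
  assumes m: "0 \<le> m" "m < 1"
  shows "0 < triple_den m (jacobi_sn u m)"
    and "jacobi_sn (3 * u) m = triple_num m (jacobi_sn u m) / triple_den m (jacobi_sn u m)"
proof -
  define s c d where defs: "s = jacobi_sn u m" "c = jacobi_cn u m" "d = jacobi_dn u m"
  define S C D where DEFS: "S = jacobi_sn (2 * u) m" "C = jacobi_cn (2 * u) m" "D = jacobi_dn (2 * u) m"
  define q where "q = 1 - m * s ^ 4"
  have sq: "c\<^sup>2 = 1 - s\<^sup>2" "d\<^sup>2 = 1 - m * s\<^sup>2"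
    unfolding defs by (simp_all add: jacobi_cn_squared jacobi_dn_squared m)
  have q_eq: "1 - m * s\<^sup>2 * s\<^sup>2 = q" by (simp add: q_def power4_eq_xxxx power2_eq_square)
  have q0: "0 < q"
    using addition_denominator_pos[OF m, of u u] unfolding defs(1)[symmetric] q_eq .
  have S: "S * q = 2 * s * c * d" and C: "C * q = c\<^sup>2 - s\<^sup>2 * d\<^sup>2" and D: "D * q = d\<^sup>2 - m * s\<^sup>2 * c\<^sup>2"
    using jacobi_addition[OF m, of u u] q0
    unfolding defs[symmetric] q_eq mult_2[symmetric] DEFS[symmetric]
    by (simp_all add: field_simps power2_eq_square)
  have "q\<^sup>2 * (1 - m * S\<^sup>2 * s\<^sup>2) = q\<^sup>2 - m * s\<^sup>2 * (S * q)\<^sup>2"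
    by (simp add: algebra_simps power_mult_distrib)
  also have "\<dots> = q\<^sup>2 - 4 * m * s ^ 4 * (c\<^sup>2 * d\<^sup>2)"
    unfolding S by (simp add: power_mult_distrib power4_eq_xxxx power2_eq_square)
  also have "\<dots> = triple_den m s"
    unfolding sq q_def triple_den_def by (simp add: algebra_simps eval_nat_numeral)
  finally have den: "q\<^sup>2 * (1 - m * S\<^sup>2 * s\<^sup>2) = triple_den m s" .
  have pos: "0 < 1 - m * S\<^sup>2 * s\<^sup>2"
    unfolding DEFS defs by (rule addition_denominator_pos[OF m])
  then show "0 < triple_den m (jacobi_sn u m)"
    using q0 unfolding defs(1)[symmetric] den[symmetric] by simp
  have "q\<^sup>2 * (S * c * d + s * C * D) = q * (S * q) * c * d + s * (C * q) * (D * q)"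
    by (simp add: algebra_simps power2_eq_square)
  also have "\<dots> = s * (2 * q * (c\<^sup>2 * d\<^sup>2) + (c\<^sup>2 - s\<^sup>2 * d\<^sup>2) * (d\<^sup>2 - m * s\<^sup>2 * c\<^sup>2))"
    unfolding S C D by (simp add: algebra_simps power2_eq_square)
  also have "\<dots> = triple_num m s"
    unfolding sq q_def triple_num_def by (simp add: algebra_simps eval_nat_numeral)
  finally have num: "q\<^sup>2 * (S * c * d + s * C * D) = triple_num m s" .
  have "jacobi_sn (3 * u) m = (S * c * d + s * C * D) / (1 - m * S\<^sup>2 * s\<^sup>2)"
    using jacobi_sn_add[OF m, of "2 * u" u] unfolding defs DEFS by simp
  also have "\<dots> = triple_num m s / triple_den m s"
    unfolding num[symmetric] den[symmetric] using q0 by simp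
  finally show "jacobi_sn (3 * u) m = triple_num m (jacobi_sn u m) / triple_den m (jacobi_sn u m)"
    by (simp add: defs)
qed

text \<open>Substituting \<open>1 - x^2 = (Y * s)^2\<close> turns every coefficient into a
  polynomial in \<open>Y * s\<close>; for instance \<open>coeff_e x\<close> becomes
  \<open>(Y * s)^9\<close>. The factor \<open>Y ^ 5\<close> then splits off.\<close>

lemma quintic_eq_triple:
  assumes "x\<^sup>2 \<le> 1" "sqrt (1 - x\<^sup>2) = Y * s"
  shows "quintic h x Y = Y ^ 5 * (h * triple_den (Y\<^sup>2) s - triple_num (Y\<^sup>2) s)"
proof -
  define X where "X = x\<^sup>2"
  \<comment> \<open>The real \<open>sqrt\<close> is odd, so its square gives back
    \<open>1 - x^2\<close> only because \<open>x^2 \<le> 1\<close>.\<close>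
  have X: "X = 1 - (Y * s)\<^sup>2"
    using assms(1) unfolding X_def assms(2)[symmetric] by simp
  have p: "x ^ 4 = X ^ 2" "x ^ 6 = X ^ 3" "x ^ 8 = X ^ 4"
    by (simp_all add: X_def flip: power_mult)
  show ?thesis
    unfolding quintic_def coeff_a_def coeff_b_def coeff_c_def coeff_d_def coeff_e_def
      assms(2) p triple_den_def triple_num_def
    unfolding X_def[symmetric]
    unfolding X
    by (simp add: algebra_simps eval_nat_numeral)
qed

text \<open>Since \<open>Y\<close> and the triplication denominator are positive, the factored
  quintic vanishes exactly when \<open>h\<close> is the triplication quotient.\<close>

lemma quintic_eq_0_iff:
  assumes "0 < Y" "Y < 1" "x\<^sup>2 \<le> 1" "sqrt (1 - x\<^sup>2) = Y * jacobi_sn u (Y\<^sup>2)"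
  shows "quintic h x Y = 0 \<longleftrightarrow> jacobi_sn (3 * u) (Y\<^sup>2) = h"
proof -
  have m: "0 \<le> Y\<^sup>2" "Y\<^sup>2 < 1" using assms by (auto simp: abs_square_less_1)
  show ?thesis
    unfolding quintic_eq_triple[OF assms(3,4)] jacobi_sn_triple(2)[OF m]
    using assms(1) jacobi_sn_triple(1)[OF m, of u] by (auto simp: field_simps)
qed

section \<open>Inverse functions and the range where they invert\<close>

lemma jacobi_sn_sn_inv:
  assumes "0 \<le> m" "m < 1" "-1 \<le> h" "h \<le> 1"
  shows "jacobi_sn (sn_inv h m) m = h"
  using assms by (simp add: jacobi_sn_def sn_inv_def jacobi_am_ellF)

text \<open>Up to the quarter period \<open>ellF (pi / 2) m\<close> the amplitude stays in
  [0, pi/2], where \<open>arcsin\<close> undoes \<open>sin\<close>.\<close>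

lemma sn_inv_jacobi_sn:
  assumes m: "0 \<le> m" "m < 1" and u: "0 \<le> u" "u \<le> ellF (pi / 2) m"
  shows "sn_inv (jacobi_sn u m) m = u"
proof -
  let ?p = "jacobi_am u m"
  have "\<not> ?p < 0" "\<not> pi / 2 < ?p"
    using ellF_strict_mono[OF m, of ?p 0] ellF_strict_mono[OF m, of "pi / 2" ?p] u
    by (auto simp: ellF_jacobi_am m)
  then have "arcsin (sin ?p) = ?p" by (intro arcsin_sin) auto
  then show ?thesis by (simp add: sn_inv_def jacobi_sn_def ellF_jacobi_am m)
qed

lemma dn_inv_eq_sn_inv: "dn_inv x m = sn_inv (sqrt ((1 - x\<^sup>2) / m)) m"
  by (simp add: dn_inv_def sn_inv_def)

text \<open>Makes \<open>dn_inv x (Y^2)\<close> the argument \<open>u\<close> of the triplication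
  criterion. The bound \<open>sqrt (1 - Y^2)\<close>, the minimum of dn, keeps the argument of
  \<open>arcsin\<close> at most 1; \<open>x < 1\<close> makes it positive, so dividing by
  \<open>dn_inv\<close> is legitimate.\<close>

lemma dn_inv_properties:
  assumes "0 < Y" "Y < 1" "sqrt (1 - Y\<^sup>2) \<le> x" "x < 1"
  shows "0 < dn_inv x (Y\<^sup>2)" "x\<^sup>2 \<le> 1" "sqrt (1 - x\<^sup>2) = Y * jacobi_sn (dn_inv x (Y\<^sup>2)) (Y\<^sup>2)"
proof -
  have m: "0 \<le> Y\<^sup>2" "Y\<^sup>2 < 1" using assms by (auto simp: abs_square_less_1)
  let ?s = "sqrt ((1 - x\<^sup>2) / Y\<^sup>2)"
  have x: "0 \<le> x" "1 - Y\<^sup>2 \<le> x\<^sup>2"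
    using assms m by (auto intro: sqrt_le_D order_trans[OF _ assms(3)])
  have x1: "x\<^sup>2 < 1" using x assms by (simp add: abs_square_less_1)
  then show "x\<^sup>2 \<le> 1" by simp
  have s: "0 < ?s" "?s \<le> 1" using x x1 assms by auto
  have "0 < arcsin ?s" using arcsin_less_arcsin[of 0 ?s] s by simp
  then show "0 < dn_inv x (Y\<^sup>2)"
    using ellF_strict_mono[OF m, of 0 "arcsin ?s"] by (simp add: dn_inv_def)
  show "sqrt (1 - x\<^sup>2) = Y * jacobi_sn (dn_inv x (Y\<^sup>2)) (Y\<^sup>2)"
    unfolding dn_inv_eq_sn_inv using s assms by (subst jacobi_sn_sn_inv[OF m]) (auto simp: real_sqrt_divide)
qed

lemma quintic_iff_jacobi_sn:
  assumes "0 < Y" "Y < 1" "sqrt (1 - Y\<^sup>2) \<le> x" "x < 1"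
  shows "quintic h x Y = 0 \<longleftrightarrow> jacobi_sn (3 * dn_inv x (Y\<^sup>2)) (Y\<^sup>2) = h"
  using quintic_eq_0_iff[OF assms(1,2) dn_inv_properties(2,3)[OF assms]] .

text \<open>The equation \<open>Y = sqrt m0\<close> pins \<open>m0\<close> down to
  \<open>Y^2\<close>, which removes the quantifier.\<close>

lemma ex_parameter_iff:
  fixes Y :: real
  assumes "0 < Y" "Y < 1"
  shows "(\<exists>m0. 0 < m0 \<and> m0 < 1 \<and> P m0 \<and> Y = sqrt m0) \<longleftrightarrow> P (Y\<^sup>2)"
proof
  assume "P (Y\<^sup>2)"
  then show "\<exists>m0. 0 < m0 \<and> m0 < 1 \<and> P m0 \<and> Y = sqrt m0"
    using assms by (intro exI[of _ "Y\<^sup>2"]) (auto simp: abs_square_less_1)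
qed auto

theorem mainTheorem1:
  shows "(\<forall>r u h x k :: real.
            r > 0 \<and> k = singular_modulus r \<and>
            h = jacobi_sn (3 * u) (k\<^sup>2) \<and> x = jacobi_dn u (k\<^sup>2) \<and>
            jacobi_sn u (k\<^sup>2) = sqrt (1 - x\<^sup>2) / k
            \<longrightarrow> quintic h x k = 0)
       \<and> (\<forall>h x Y :: real.
            0 < Y \<and> Y < 1 \<and> sqrt (1 - Y\<^sup>2) \<le> x \<and> x < 1 \<longrightarrow>
              (quintic h x Y = 0 \<longleftrightarrow>
                 (\<exists>m0 v. 0 < m0 \<and> m0 < 1 \<and> jacobi_sn v m0 = h \<and>
                         v / dn_inv x m0 = 3 \<and> Y = sqrt m0))
            \<and> (-1 \<le> h \<and> h \<le> 1 \<longrightarrow>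
                 (\<exists>m0. 0 < m0 \<and> m0 < 1 \<and> sn_inv h m0 / dn_inv x m0 = 3 \<and> Y = sqrt m0)
                 \<longrightarrow> quintic h x Y = 0)
            \<and> (-1 \<le> h \<and> h \<le> 1 \<and> 3 * dn_inv x (Y\<^sup>2) \<le> ellF (pi / 2) (Y\<^sup>2) \<longrightarrow>
                 (quintic h x Y = 0 \<longleftrightarrow>
                    (\<exists>m0. 0 < m0 \<and> m0 < 1 \<and> sn_inv h m0 / dn_inv x m0 = 3 \<and> Y = sqrt m0))))"
proof (intro conjI allI impI; (elim conjE)?)
  fix r u h x k :: real
  assume A: "r > 0" "k = singular_modulus r" "h = jacobi_sn (3 * u) (k\<^sup>2)"
    "x = jacobi_dn u (k\<^sup>2)" "jacobi_sn u (k\<^sup>2) = sqrt (1 - x\<^sup>2) / k"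
  have k: "0 < k" "k < 1" using singular_modulus_bounds[OF A(1)] A(2) by auto
  then have "x\<^sup>2 = 1 - k\<^sup>2 * (jacobi_sn u (k\<^sup>2))\<^sup>2"
    unfolding A(4) by (intro jacobi_dn_squared) (auto simp: abs_square_less_1)
  then have "x\<^sup>2 \<le> 1" by simp
  \<comment> \<open>The value of dn fixes sn only up to sign; the assumed relation between
    \<open>x\<close> and sn selects the nonnegative one.\<close>
  moreover have "sqrt (1 - x\<^sup>2) = k * jacobi_sn u (k\<^sup>2)" using A(5) k by simp
  ultimately show "quintic h x k = 0" using quintic_eq_0_iff[OF k] A(3) by blast
next
  fix h x Y :: real
  assume Y: "0 < Y" "Y < 1" and x: "sqrt (1 - Y\<^sup>2) \<le> x" "x < 1"
  have m: "0 \<le> Y\<^sup>2" "Y\<^sup>2 < 1" using Y by (auto simp: abs_square_less_1)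
  let ?v = "dn_inv x (Y\<^sup>2)"
  note v = dn_inv_properties(1)[OF Y x]
  note root_iff = quintic_iff_jacobi_sn[OF Y x, of h]
  \<comment> \<open>Positivity of \<open>?v\<close> excludes the convention that division by 0 gives
    0.\<close>
  have ratio: "w / ?v = 3 \<longleftrightarrow> w = 3 * ?v" for w
    using v by (auto simp: field_simps)
  have "(\<exists>m0 v. 0 < m0 \<and> m0 < 1 \<and> jacobi_sn v m0 = h \<and> v / dn_inv x m0 = 3 \<and> Y = sqrt m0) \<longleftrightarrow>
      (\<exists>m0. 0 < m0 \<and> m0 < 1 \<and> (\<exists>v. jacobi_sn v m0 = h \<and> v / dn_inv x m0 = 3) \<and> Y = sqrt m0)"
    by blast
  also have "\<dots> \<longleftrightarrow> (\<exists>v. jacobi_sn v (Y\<^sup>2) = h \<and> v / ?v = 3)"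
    by (rule ex_parameter_iff[OF Y])
  finally show "quintic h x Y = 0 \<longleftrightarrow>
      (\<exists>m0 v. 0 < m0 \<and> m0 < 1 \<and> jacobi_sn v m0 = h \<and> v / dn_inv x m0 = 3 \<and> Y = sqrt m0)"
    unfolding root_iff ratio by blast
  note ex_iff = ex_parameter_iff[OF Y, of "\<lambda>m0. sn_inv h m0 / dn_inv x m0 = 3"]
  \<comment> \<open>This direction needs no quarter-period bound: \<open>jacobi_sn\<close> undoes
    \<open>sn_inv\<close> on all of [-1,1].\<close>
  have root: "quintic h x Y = 0" if "-1 \<le> h" "h \<le> 1" "sn_inv h (Y\<^sup>2) = 3 * ?v"
    unfolding root_iff that(3)[symmetric] by (rule jacobi_sn_sn_inv[OF m that(1,2)])
  show "quintic h x Y = 0" if "-1 \<le> h" "h \<le> 1"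
    "\<exists>m0. 0 < m0 \<and> m0 < 1 \<and> sn_inv h m0 / dn_inv x m0 = 3 \<and> Y = sqrt m0"
    using root that unfolding ex_iff ratio by blast
  \<comment> \<open>For the converse, a root gives only \<open>jacobi_sn (3 * ?v) (Y^2) = h\<close>;
    the quarter-period bound lets \<open>sn_inv\<close> recover \<open>3 * ?v\<close> from
    \<open>h\<close>.\<close>
  show "quintic h x Y = 0 \<longleftrightarrow>
      (\<exists>m0. 0 < m0 \<and> m0 < 1 \<and> sn_inv h m0 / dn_inv x m0 = 3 \<and> Y = sqrt m0)"
    if "-1 \<le> h" "h \<le> 1" "3 * ?v \<le> ellF (pi / 2) (Y\<^sup>2)"
    unfolding ex_iff ratio
    using root[OF that(1,2)] sn_inv_jacobi_sn[OF m _ that(3)] v root_iff by auto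
qed

end
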